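(* Let $L$ be a frame. The following are equivalent. (1) The frame $L$ is spatial and the space $\mathsf{pt}(L)$ is scattered. (2) The frame $L$ is totally spatial and every prime of $L$ is weakly covered. (3) The map $\mathsf{pt}:\mathsf{S}(L)\to\mathcal{P}(\mathsf{pt}(L))$, $S\mapsto\mathsf{pt}(S)=\mathsf{pt}(L)\cap S$, is an isomorphism (of coframes). (4) There exists an isomorphism $\mathsf{S}(L)\cong\mathcal{P}(\mathsf{pt}(L))$. (5) The coframe $\mathsf{S}(L)$ is Boolean and $L$ is spatial. (6) The frame $L$ is spatial and all elements of $L$ other than $1$ have an absolutely essential prime. (7) Every element of $L$ is the meet of its absolutely essential primes. (8) The frame $L$ is spatial and every subspace of $\mathsf{pt}(L)$ has a discrete dense subspace.
   Context: For a frame $L$, a prime is an element $p\neq 1$ such that $x\wedge y\leq p$ implies $x\leq p$ or $y\leq p$. $\mathsf{pt}(L)$ is the set of primes of $L$, topologized with open sets $\{p\in\mathsf{pt}(L): a\nleq p\}$, $a\in L$. A frame is spatial if every element is a meet of primes. A prime $p$ is weakly covered if, for every $P\subseteq\mathsf{pt}(L)$, $p=\bigwedge P$ implies $p\in P$. A sublocale of $L$ is a subset $S\subseteq L$ closed under arbitrary meets (so $1\in S$) such that $s\in S$ implies $x\to s\in S$ for all $x\in L$; it is itself a frame in the inherited order. $\mathsf{S}(L)$ is the coframe of all sublocales ordered by inclusion. For a sublocale $S$, the primes of the frame $S$ are exactly the elements of $\mathsf{pt}(S)=\mathsf{pt}(L)\cap S$. $L$ is totally spatial if all its sublocales are spatial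 frames. $\mathcal{P}(\mathsf{pt}(L))$ is the powerset of $\mathsf{pt}(L)$ ordered by inclusion. A space is scattered if every nonempty subspace has an isolated point (isolated in that subspace). For $a\in L$ which is the meet of the primes above it, a prime $p$ is an absolutely essential prime of $a$ if $a\leq p$ and, for every $P\subseteq\mathsf{pt}(L)$, $a=\bigwedge P$ implies $p\in P$. *)

theory Defs
  imports "HOL-Analysis.Abstract_Topology"
begin

text \<open>The library class \<^class>\<open>complete_distrib_lattice\<close> demands complete distributivity, which is
  strictly stronger than the frame law, so frames get a class of their own.\<close>

class frame = complete_lattice +
  assumes inf_Sup_frame: "inf a (Sup B) = Sup (inf a ` B)"

definition heyting_imp :: "'a::frame \<Rightarrow> 'a \<Rightarrow> 'a"  (infixr \<open>\<rightarrow>\<^sub>H\<close> 60)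
  where "x \<rightarrow>\<^sub>H y = Sup {z. inf z x \<le> y}"

lemma le_heyting_imp_iff:
  fixes x y z :: "'a::frame"
  shows "z \<le> x \<rightarrow>\<^sub>H y \<longleftrightarrow> inf z x \<le> y"
proof
  have *: "inf x (x \<rightarrow>\<^sub>H y) \<le> y"
    unfolding heyting_imp_def inf_Sup_frame by (rule Sup_least) (auto simp: inf.commute)
  assume "z \<le> x \<rightarrow>\<^sub>H y"
  then have "inf z x \<le> inf x (x \<rightarrow>\<^sub>H y)"
    by (simp add: le_infI1)
  with * show "inf z x \<le> y" by (rule order_trans[rotated])
qed (simp add: heyting_imp_def Sup_upper)

definition is_sublocale :: "'a::frame set \<Rightarrow> bool"
  where "is_sublocale S \<longleftrightarrow> (\<forall>M\<subseteq>S. Inf M \<in> S) \<and> (\<forall>x. \<forall>s\<in>S. x \<rightarrow>\<^sub>H s \<in> S)"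

definition sublocales :: "'a::frame set set"
  where "sublocales = {S. is_sublocale S}"

text \<open>The next two notions concern a sublocale \<open>S\<close>, regarded as a frame in the inherited order; meets and
  the top element of \<open>S\<close> are those of the ambient frame. The ambient frame itself is the case \<open>S = UNIV\<close>.\<close>

definition pt :: "'a::frame set \<Rightarrow> 'a set"
  where "pt S = {p \<in> S. p \<noteq> top \<and> (\<forall>x\<in>S. \<forall>y\<in>S. inf x y \<le> p \<longrightarrow> x \<le> p \<or> y \<le> p)}"

definition spatial :: "'a::frame set \<Rightarrow> bool"
  where "spatial S \<longleftrightarrow> (\<forall>a\<in>S. \<exists>P\<subseteq>pt S. a = Inf P)"

lemma pt_sublocale:
  assumes "is_sublocale S"
  shows "pt S = pt UNIV \<inter> S"
proof (intro equalityI subsetI)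
  fix p assume p: "p \<in> pt S"
  then have pS: "p \<in> S" by (simp add: pt_def)
  have "x \<le> p \<or> y \<le> p" if xy: "inf x y \<le> p" for x y
  proof -
    define u where "u = x \<rightarrow>\<^sub>H p"
    define v where "v = u \<rightarrow>\<^sub>H p"
    have uv: "u \<in> S" "v \<in> S"
      using assms pS unfolding is_sublocale_def u_def v_def by blast+
    have "inf v u \<le> p"
      unfolding le_heyting_imp_iff[symmetric] v_def ..
    then have "v \<le> p \<or> u \<le> p"
      using p uv unfolding pt_def by blast
    moreover have "y \<le> u"
      using xy unfolding u_def le_heyting_imp_iff by (simp only: inf.commute)
    moreover have "x \<le> v"
    proof -
      have "inf u x \<le> p"
        unfolding le_heyting_imp_iff[symmetric] u_def ..
      then show ?thesis
        unfolding v_def le_heyting_imp_iff by (simp only: inf.commute)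
    qed
    ultimately show ?thesis
      by (meson order_trans)
  qed
  then show "p \<in> pt UNIV \<inter> S"
    using p unfolding pt_def by blast
next
  fix p assume "p \<in> pt UNIV \<inter> S"
  then show "p \<in> pt S"
    unfolding pt_def by blast
qed

definition totally_spatial :: "'a::frame itself \<Rightarrow> bool"
  where "totally_spatial _ \<longleftrightarrow> (\<forall>S\<in>(sublocales :: 'a set set). spatial S)"

definition weakly_covered :: "'a::frame \<Rightarrow> bool"
  where "weakly_covered p \<longleftrightarrow> (\<forall>P\<subseteq>pt UNIV. p = Inf P \<longrightarrow> p \<in> P)"

definition abs_essential :: "'a::frame \<Rightarrow> 'a set"
  where "abs_essential a =
    {p \<in> pt UNIV. a = Inf {q \<in> pt UNIV. a \<le> q} \<and> a \<le> p \<and> (\<forall>P\<subseteq>pt UNIV. a = Inf P \<longrightarrow> p \<in> P)}"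

definition pt_space :: "'a::frame topology"
  where "pt_space = topology (\<lambda>U. \<exists>a. U = {p \<in> pt UNIV. \<not> a \<le> p})"

lemma openin_pt_space:
  "openin pt_space U \<longleftrightarrow> (\<exists>a::'a::frame. U = {p \<in> pt UNIV. \<not> a \<le> p})"
proof -
  define Op where "Op = (\<lambda>a::'a. {p \<in> pt UNIV. \<not> a \<le> p})"
  have int: "Op a \<inter> Op b = Op (inf a b)" for a b
  proof -
    have "inf a b \<le> p \<longleftrightarrow> a \<le> p \<or> b \<le> p" if "p \<in> pt UNIV" for p
    proof
      assume "inf a b \<le> p"
      with that show "a \<le> p \<or> b \<le> p" by (simp add: pt_def)
    next
      assume "a \<le> p \<or> b \<le> p"
      then show "inf a b \<le> p" by (elim disjE) (rule le_infI1 le_infI2, assumption)+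
    qed
    then show ?thesis unfolding Op_def by blast
  qed
  have Sup: "\<exists>a. \<Union>K = Op a" if K: "\<forall>U\<in>K. \<exists>a. U = Op a" for K
  proof
    have "K = Op ` {a. Op a \<in> K}"
    proof (intro equalityI subsetI)
      fix U assume U: "U \<in> K"
      with K obtain a where "U = Op a" by metis
      with U show "U \<in> Op ` {a. Op a \<in> K}" by simp
    qed (elim imageE, simp)
    then have "\<Union>K = (\<Union>a\<in>{a. Op a \<in> K}. Op a)"
      by (rule arg_cong)
    also have "\<dots> = Op (Sup {a. Op a \<in> K})"
    proof -
      have "(\<Union>a\<in>I. Op a) = Op (Sup I)" for I
        unfolding Op_def Sup_le_iff by blast
      then show ?thesis .
    qed
    finally show "\<Union>K = Op (Sup {a. Op a \<in> K})" .
  qed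
  have "istopology (\<lambda>U. \<exists>a. U = Op a)"
    unfolding istopology_def
  proof (intro conjI allI impI)
    fix S T assume "\<exists>a. S = Op a" "\<exists>a. T = Op a"
    then show "\<exists>a. S \<inter> T = Op a"
      using int by metis
  next
    fix K assume "\<forall>U\<in>K. \<exists>a. U = Op a"
    then show "\<exists>a. \<Union>K = Op a" by (rule Sup)
  qed
  then have "openin (topology (\<lambda>U. \<exists>a. U = Op a)) U \<longleftrightarrow> (\<exists>a. U = Op a)"
    by (simp only: topology_inverse')
  then show ?thesis
    by (simp only: pt_space_def Op_def)
qed

lemma topspace_pt_space: "topspace pt_space = (pt UNIV :: 'a::frame set)"
proof -
  have "openin pt_space (pt UNIV :: 'a set)"
    unfolding openin_pt_space by (rule exI[of _ top]) (auto simp: pt_def top.extremum_unique)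
  moreover have "U \<subseteq> pt UNIV" if "openin pt_space U" for U :: "'a set"
    using that by (auto simp: openin_pt_space)
  ultimately show ?thesis
    by (intro equalityI openin_subset) (simp_all add: openin_topspace)
qed

definition scattered_space :: "'b topology \<Rightarrow> bool"
  where "scattered_space X \<longleftrightarrow>
    (\<forall>Y\<subseteq>topspace X. Y \<noteq> {} \<longrightarrow> (\<exists>p\<in>Y. openin (subtopology X Y) {p}))"

definition has_discrete_dense_subspace :: "'b topology \<Rightarrow> bool"
  where "has_discrete_dense_subspace X \<longleftrightarrow>
    (\<exists>D\<subseteq>topspace X. subtopology X D = discrete_topology D \<and> X closure_of D = topspace X)"

text \<open>Meets and joins in the poset \<open>A\<close> with the order inherited from the ambient type. For
  \<^term>\<open>sublocales\<close> and \<^term>\<open>Pow Z\<close> this is inclusion. A join of sublocales is in general larger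
  than their union, and the empty meet in \<^term>\<open>Pow Z\<close> is \<open>Z\<close>.\<close>

definition is_meet :: "'b::order set \<Rightarrow> 'b set \<Rightarrow> 'b \<Rightarrow> bool"
  where "is_meet A F m \<longleftrightarrow> m \<in> A \<and> (\<forall>x\<in>F. m \<le> x) \<and> (\<forall>z\<in>A. (\<forall>x\<in>F. z \<le> x) \<longrightarrow> z \<le> m)"

definition is_join :: "'b::order set \<Rightarrow> 'b set \<Rightarrow> 'b \<Rightarrow> bool"
  where "is_join A F j \<longleftrightarrow> j \<in> A \<and> (\<forall>x\<in>F. x \<le> j) \<and> (\<forall>z\<in>A. (\<forall>x\<in>F. x \<le> z) \<longrightarrow> j \<le> z)"

text \<open>Coframe homomorphisms preserve arbitrary meets and finite joins, the empty ones included.\<close>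

definition coframe_hom :: "'b::order set \<Rightarrow> 'c::order set \<Rightarrow> ('b \<Rightarrow> 'c) \<Rightarrow> bool"
  where "coframe_hom A B f \<longleftrightarrow> f ` A \<subseteq> B \<and>
    (\<forall>F\<subseteq>A. \<forall>m. is_meet A F m \<longrightarrow> is_meet B (f ` F) (f m)) \<and>
    (\<forall>F\<subseteq>A. finite F \<longrightarrow> (\<forall>j. is_join A F j \<longrightarrow> is_join B (f ` F) (f j)))"

definition coframe_iso :: "'b::order set \<Rightarrow> 'c::order set \<Rightarrow> ('b \<Rightarrow> 'c) \<Rightarrow> bool"
  where "coframe_iso A B f \<longleftrightarrow>
    bij_betw f A B \<and> coframe_hom A B f \<and> coframe_hom B A (the_inv_into A f)"

text \<open>A coframe is Boolean if all its elements are complemented. The empty join is the bottom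
  and the empty meet the top of \<open>A\<close>.\<close>

definition boolean_coframe :: "'b::order set \<Rightarrow> bool"
  where "boolean_coframe A \<longleftrightarrow> (\<exists>b t. is_join A {} b \<and> is_meet A {} t \<and>
    (\<forall>x\<in>A. \<exists>y\<in>A. is_meet A {x, y} b \<and> is_join A {x, y} t))"

definition all_equivalent :: "bool list \<Rightarrow> bool"
  where "all_equivalent \<phi>s \<longleftrightarrow> (\<forall>\<phi>\<in>set \<phi>s. \<forall>\<psi>\<in>set \<phi>s. \<phi> \<longleftrightarrow> \<psi>)"

end

theory Submission
  imports Defs "HOL-Analysis.Abstract_Topological_Spaces"
begin

text \<open>
  The proof runs through three groups of conditions.

  \<^emph>\<open>Points and topology.\<close> The closed sets of \<^term>\<open>pt_space\<close> are the sets \<open>V a\<close> of all primes above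
  \<open>a\<close>, and in a spatial frame an absolutely essential prime of \<open>a\<close> is the same thing as an isolated
  point of \<open>V a\<close> (\<open>abs_essential_iff_isolated\<close>). The isolated points of the closure of a set \<open>Y\<close> of
  primes lie in \<open>Y\<close> and are isolated there, so it suffices to look for isolated points in closed sets,
  and scatteredness says that every \<open>a \<noteq> 1\<close> has an absolutely essential prime.
  If it has one, then it is even the meet of all of them: were \<open>b\<close>, the meet of these, not below
  \<open>a\<close>, an absolutely essential prime of \<open>b \<rightarrow> a\<close> would be one of \<open>a\<close> that is not above \<open>b\<close>
  (\<open>abs_essential_heyting_imp\<close>). That scatteredness amounts to discrete dense subspaces holds in
  every \<open>T\<^sub>0\<close> space (\<open>scattered_iff_discrete_dense\<close>).

  \<^emph>\<open>From points to sublocales.\<close> An absolutely essential prime of \<open>a\<close> has the form \<open>b \<rightarrow> a\<close>, so it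
  belongs to every sublocale that contains \<open>a\<close>. If every element is the meet of such primes, then
  every sublocale is spatial. Conversely the meets of members of any set \<open>Y\<close> of primes form a
  sublocale, and weak covering says that this sublocale has no primes outside \<open>Y\<close>. The two together
  make \<open>S \<mapsto> pt S\<close> an order isomorphism, and hence a coframe isomorphism, onto the powerset.

  \<^emph>\<open>From sublocales back to points.\<close> Any isomorphism onto the powerset of the primes makes the coframe
  of sublocales Boolean. It also makes the frame spatial, because the atoms of that coframe are the
  sublocales \<open>{1, p}\<close> with \<open>p\<close> prime. Finally, suppose that all sublocales are complemented and that
  the frame is spatial. A complement of \<open>{1, p}\<close> contains all primes other than \<open>p\<close>
  (\<open>prime_in_complement\<close>), which gives weak covering. For \<open>a \<noteq> 1\<close> the sublocale of all \<open>x \<rightarrow> a\<close>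
  contains a prime, since otherwise its complement would contain all primes; weak covering shows that
  this prime is absolutely essential for \<open>a\<close>.
\<close>

section \<open>Meets of primes\<close>

lemma prime_inf_le_iff:
  "p \<in> pt UNIV \<Longrightarrow> inf x y \<le> p \<longleftrightarrow> x \<le> p \<or> y \<le> p"
  by (auto simp: pt_def intro: le_infI1 le_infI2)

lemma Inf_primes_above:
  fixes a :: "'a::frame"
  assumes "spatial (UNIV :: 'a set)"
  shows "Inf {p \<in> pt UNIV. a \<le> p} = a"
proof -
  obtain P where P: "P \<subseteq> pt UNIV" "a = Inf P"
    using assms by (auto simp: spatial_def)
  then have "P \<subseteq> {p \<in> pt UNIV. a \<le> p}"
    by (auto intro: Inf_lower)
  then show ?thesis
    using P by (intro antisym) (auto intro: Inf_superset_mono Inf_greatest)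
qed

text \<open>For a prime \<open>p\<close> the implication \<open>x \<rightarrow> p\<close> can only be \<open>1\<close> or \<open>p\<close>, and implication preserves
  meets in its second argument. This computation drives most of what follows.\<close>

lemma heyting_imp_Inf_primes:
  fixes x :: "'a::frame"
  assumes "P \<subseteq> pt UNIV"
  shows "x \<rightarrow>\<^sub>H Inf P = Inf {p \<in> P. \<not> x \<le> p}"
proof -
  have "z \<le> x \<rightarrow>\<^sub>H Inf P \<longleftrightarrow> z \<le> Inf {p \<in> P. \<not> x \<le> p}" for z
  proof -
    have "z \<le> x \<rightarrow>\<^sub>H Inf P \<longleftrightarrow> (\<forall>p\<in>P. inf z x \<le> p)"
      by (simp add: le_heyting_imp_iff le_Inf_iff)
    also have "\<dots> \<longleftrightarrow> (\<forall>p\<in>P. z \<le> p \<or> x \<le> p)"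
      using assms by (intro ball_cong refl prime_inf_le_iff) auto
    also have "\<dots> \<longleftrightarrow> z \<le> Inf {p \<in> P. \<not> x \<le> p}"
      by (auto simp: le_Inf_iff)
    finally show ?thesis .
  qed
  then show ?thesis
    by (meson antisym order_refl)
qed

definition meets :: "'a::complete_lattice set \<Rightarrow> 'a set"
  where "meets Y = {Inf P | P. P \<subseteq> Y}"

lemma mem_meets_iff: "a \<in> meets Y \<longleftrightarrow> Inf {p \<in> Y. a \<le> p} \<le> a"
proof
  assume "a \<in> meets Y"
  then obtain P where "P \<subseteq> Y" "a = Inf P"
    by (auto simp: meets_def)
  then show "Inf {p \<in> Y. a \<le> p} \<le> a"
    by (auto intro!: Inf_superset_mono intro: Inf_lower)
next
  assume "Inf {p \<in> Y. a \<le> p} \<le> a"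
  then have "a = Inf {p \<in> Y. a \<le> p}"
    by (simp add: order.eq_iff le_Inf_iff)
  then show "a \<in> meets Y"
    unfolding meets_def by blast
qed

lemma subset_meets: "Y \<subseteq> meets Y"
  by (auto simp: mem_meets_iff intro: Inf_lower)

lemma is_sublocale_meets:
  fixes Y :: "'a::frame set"
  assumes "Y \<subseteq> pt UNIV"
  shows "is_sublocale (meets Y)"
  unfolding is_sublocale_def
proof (intro conjI allI impI ballI)
  fix M assume M: "M \<subseteq> meets Y"
  show "Inf M \<in> meets Y"
    unfolding mem_meets_iff
  proof (rule Inf_greatest)
    fix m assume m: "m \<in> M"
    have "Inf {p \<in> Y. Inf M \<le> p} \<le> Inf {p \<in> Y. m \<le> p}"
      using m by (intro Inf_superset_mono) (auto intro: Inf_lower2)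
    also have "\<dots> \<le> m"
      using M m by (auto simp: mem_meets_iff)
    finally show "Inf {p \<in> Y. Inf M \<le> p} \<le> m" .
  qed
next
  fix x s assume "s \<in> meets Y"
  then obtain P where P: "P \<subseteq> Y" "s = Inf P"
    by (auto simp: meets_def)
  then have "x \<rightarrow>\<^sub>H s = Inf {p \<in> P. \<not> x \<le> p}"
    using assms by (auto intro!: heyting_imp_Inf_primes)
  then show "x \<rightarrow>\<^sub>H s \<in> meets Y"
    using P unfolding meets_def by blast
qed

lemma meets_least_sublocale:
  assumes "is_sublocale S" "Y \<subseteq> S"
  shows "meets Y \<subseteq> S"
  using assms by (auto simp: meets_def is_sublocale_def)

lemma spatial_iff_subset_meets: "spatial S \<longleftrightarrow> S \<subseteq> meets (pt S)"
  by (auto simp: spatial_def meets_def)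

lemma is_sublocale_UNIV: "is_sublocale UNIV"
  by (simp add: is_sublocale_def)

lemma heyting_imp_top: "x \<rightarrow>\<^sub>H top = top"
  using le_heyting_imp_iff[of top x top] by (simp add: top_unique)

lemma is_sublocale_top: "is_sublocale {top}"
  using heyting_imp_top by (auto simp: is_sublocale_def intro: Inf_eqI)

lemma top_in_sublocale: "is_sublocale S \<Longrightarrow> top \<in> S"
  by (metis Inf_empty empty_subsetI is_sublocale_def)

section \<open>Absolutely essential primes\<close>

text \<open>The condition on the right says that the open set of all primes not above the meet of
  \<open>V a - {p}\<close> separates \<open>p\<close> from the rest of \<open>V a\<close>. It suffices to test \<open>P = V a - {p}\<close>
  since this is the largest set of primes above \<open>a\<close> that omits \<open>p\<close>.\<close>

lemma abs_essential_iff_isolated: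
  fixes a p :: "'a::frame"
  assumes "a = Inf {q \<in> pt UNIV. a \<le> q}"
  shows "p \<in> abs_essential a \<longleftrightarrow>
    p \<in> pt UNIV \<and> a \<le> p \<and> \<not> Inf ({q \<in> pt UNIV. a \<le> q} - {p}) \<le> p"
proof -
  define V where "V = {q \<in> pt UNIV. a \<le> q}"
  have a: "a = Inf V"
    using assms by (simp add: V_def)
  have "(\<forall>P\<subseteq>pt UNIV. a = Inf P \<longrightarrow> p \<in> P) \<longleftrightarrow> \<not> Inf (V - {p}) \<le> p" if p: "p \<in> V"
  proof
    assume ess: "\<forall>P\<subseteq>pt UNIV. a = Inf P \<longrightarrow> p \<in> P"
    have "Inf V = inf p (Inf (V - {p}))"
      using complete_lattice_class.Inf_insert[of p "V - {p}"] p by (simp add: insert_absorb)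
    moreover have "a \<noteq> Inf (V - {p})"
    proof
      assume "a = Inf (V - {p})"
      moreover have "V - {p} \<subseteq> pt UNIV"
        by (auto simp: V_def)
      ultimately have "p \<in> V - {p}"
        using ess by blast
      then show False by simp
    qed
    ultimately show "\<not> Inf (V - {p}) \<le> p"
      using a by (metis inf.absorb2)
  next
    assume iso: "\<not> Inf (V - {p}) \<le> p"
    show "\<forall>P\<subseteq>pt UNIV. a = Inf P \<longrightarrow> p \<in> P"
    proof (intro allI impI, rule ccontr)
      fix P assume P: "P \<subseteq> pt UNIV" "a = Inf P" "p \<notin> P"
      then have "P \<subseteq> V - {p}"
        by (auto simp: V_def intro: Inf_lower)
      then have "Inf (V - {p}) \<le> a"
        using P by (auto intro: Inf_superset_mono)
      with p iso show False
        by (auto simp: V_def)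
    qed
  qed
  then show ?thesis
    using assms unfolding abs_essential_def V_def by auto
qed

lemma abs_essential_in_meet:
  "p \<in> abs_essential a \<Longrightarrow> P \<subseteq> pt UNIV \<Longrightarrow> a = Inf P \<Longrightarrow> p \<in> P"
  by (auto simp: abs_essential_def)

text \<open>Passing from \<open>a\<close> to \<open>b \<rightarrow> a\<close> deletes from any representation of \<open>a\<close> as a meet of primes exactly those above
  \<open>b\<close>; what is essential for the remaining part is essential for the whole.\<close>

lemma abs_essential_heyting_imp:
  fixes a b p :: "'a::frame"
  assumes spatial: "spatial (UNIV :: 'a set)"
    and p: "p \<in> abs_essential (b \<rightarrow>\<^sub>H a)"
  shows "p \<in> abs_essential a" and "\<not> b \<le> p"
proof -
  have part: "p \<in> P \<and> \<not> b \<le> p" if P: "P \<subseteq> pt UNIV" "a = Inf P" for P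
  proof -
    have "b \<rightarrow>\<^sub>H a = Inf {q \<in> P. \<not> b \<le> q}"
      using P by (simp add: heyting_imp_Inf_primes)
    then have "p \<in> {q \<in> P. \<not> b \<le> q}"
      using P by (intro abs_essential_in_meet[OF p]) auto
    then show ?thesis by simp
  qed
  have V: "a = Inf {q \<in> pt UNIV. a \<le> q}"
    using Inf_primes_above[OF spatial] by simp
  with part[of "{q \<in> pt UNIV. a \<le> q}"] part
  show "p \<in> abs_essential a" "\<not> b \<le> p"
    by (auto simp: abs_essential_def)
qed

lemma eq_Inf_abs_essential:
  fixes a :: "'a::frame"
  assumes spatial: "spatial (UNIV :: 'a set)"
    and ess: "\<And>a::'a. a \<noteq> top \<Longrightarrow> abs_essential a \<noteq> {}"
  shows "a = Inf (abs_essential a)"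
proof (rule antisym)
  show "a \<le> Inf (abs_essential a)"
    by (auto simp: abs_essential_def intro: Inf_greatest)
next
  define b where "b = Inf (abs_essential a)"
  have "b \<rightarrow>\<^sub>H a = top"
  proof (rule ccontr)
    assume "b \<rightarrow>\<^sub>H a \<noteq> top"
    then obtain p where "p \<in> abs_essential (b \<rightarrow>\<^sub>H a)"
      using ess by blast
    then have "p \<in> abs_essential a" "\<not> b \<le> p"
      using abs_essential_heyting_imp[OF spatial] by auto
    then show False
      by (auto simp: b_def intro: Inf_lower)
  qed
  then show "Inf (abs_essential a) \<le> a"
    using le_heyting_imp_iff[of top b a] by (simp add: b_def)
qed

text \<open>With \<open>b\<close> the meet of all primes above \<open>a\<close> except \<open>p\<close>, the prime \<open>p\<close> equals \<open>b \<rightarrow> a\<close>: it is the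
  only prime above \<open>a\<close> that is not above \<open>b\<close>.\<close>

lemma abs_essential_in_sublocale:
  assumes S: "is_sublocale S" and a: "a \<in> S" and p: "p \<in> abs_essential a"
  shows "p \<in> S"
proof -
  define V where "V = {q \<in> pt UNIV. a \<le> q}"
  have aV: "a = Inf V" and pV: "p \<in> V"
    using p by (auto simp: abs_essential_def V_def)
  then have iso: "\<not> Inf (V - {p}) \<le> p"
    using p abs_essential_iff_isolated[of a p] by (auto simp: V_def)
  have "Inf (V - {p}) \<rightarrow>\<^sub>H a = Inf {q \<in> V. \<not> Inf (V - {p}) \<le> q}"
    unfolding aV by (rule heyting_imp_Inf_primes) (auto simp: V_def)
  also have "{q \<in> V. \<not> Inf (V - {p}) \<le> q} = {p}"
    using iso pV by (auto intro: Inf_lower)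
  finally show ?thesis
    using S a by (metis complete_lattice_class.Inf_insert Inf_empty inf_top_right is_sublocale_def)
qed

section \<open>Scattered spaces and discrete dense subspaces\<close>

lemma openin_singleton_subtopology:
  "openin (subtopology X Y) {p} \<longleftrightarrow> (\<exists>U. openin X U \<and> U \<inter> Y = {p})"
  by (auto simp: openin_subtopology)

lemma discrete_dense_subtopology_iff:
  assumes "Y \<subseteq> topspace X"
  shows "has_discrete_dense_subspace (subtopology X Y) \<longleftrightarrow>
    (\<exists>D\<subseteq>Y. (\<forall>d\<in>D. \<exists>U. openin X U \<and> U \<inter> D = {d}) \<and>
      (\<forall>U. openin X U \<and> U \<inter> Y \<noteq> {} \<longrightarrow> U \<inter> D \<noteq> {}))"
proof -
  have top: "topspace (subtopology X Y) = Y"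
    using assms by auto
  have discrete: "subtopology (subtopology X Y) D = discrete_topology D \<longleftrightarrow>
      (\<forall>d\<in>D. \<exists>U. openin X U \<and> U \<inter> D = {d})" if D: "D \<subseteq> Y" for D
  proof -
    have sub: "subtopology (subtopology X Y) D = subtopology X D"
      using D by (simp add: subtopology_subtopology inf.absorb2)
    have "topspace (subtopology X D) = D"
      using D assms by auto
    then show ?thesis
      unfolding sub openin_singleton_subtopology[symmetric]
      by (metis discrete_topology_unique)
  qed
  have dense: "(subtopology X Y) closure_of D = Y \<longleftrightarrow>
      (\<forall>U. openin X U \<and> U \<inter> Y \<noteq> {} \<longrightarrow> U \<inter> D \<noteq> {})" if D: "D \<subseteq> Y" for D
  proof -
    have "(subtopology X Y) closure_of D = Y \<longleftrightarrow> Y \<subseteq> (subtopology X Y) closure_of D"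
      using closure_of_subset_topspace[of "subtopology X Y" D] top by auto
    also have "\<dots> \<longleftrightarrow> (\<forall>U. openin X U \<and> U \<inter> Y \<noteq> {} \<longrightarrow> U \<inter> D \<noteq> {})"
    proof (intro iffI allI impI subsetI)
      fix U assume cl: "Y \<subseteq> (subtopology X Y) closure_of D" and U: "openin X U \<and> U \<inter> Y \<noteq> {}"
      then obtain y where "y \<in> U \<inter> Y" "y \<in> (subtopology X Y) closure_of D"
        by blast
      moreover have "openin (subtopology X Y) (U \<inter> Y)"
        using U by (auto simp: openin_subtopology)
      ultimately show "U \<inter> D \<noteq> {}"
        unfolding in_closure_of by blast
    next
      fix y assume dense: "\<forall>U. openin X U \<and> U \<inter> Y \<noteq> {} \<longrightarrow> U \<inter> D \<noteq> {}" and y: "y \<in> Y"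
      have "\<exists>z. z \<in> D \<and> z \<in> T" if T: "y \<in> T" "openin (subtopology X Y) T" for T
      proof -
        obtain U where "openin X U" "T = U \<inter> Y"
          using T by (auto simp: openin_subtopology)
        then show ?thesis
          using dense T D by blast
      qed
      then show "y \<in> (subtopology X Y) closure_of D"
        unfolding in_closure_of top using y by blast
    qed
    finally show ?thesis .
  qed
  show ?thesis
    unfolding has_discrete_dense_subspace_def top
    by (intro ex_cong1 conj_cong refl discrete dense)
qed

text \<open>A point \<open>d\<close> of a discrete dense set \<open>D\<close> need not be isolated in \<open>Y\<close>, but it is generic in an
  open part of \<open>Y\<close>: if \<open>U\<close> meets \<open>D\<close> in \<open>d\<close> alone, then every open set that meets \<open>U \<inter> Y\<close> meets
  \<open>U \<inter> D = {d}\<close>.\<close>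

lemma generic_point_of_discrete_dense:
  assumes "Y \<subseteq> topspace X" "Y \<noteq> {}" "has_discrete_dense_subspace (subtopology X Y)"
  obtains d U where "d \<in> Y" "openin X U" "d \<in> U"
    "\<And>W. openin X W \<Longrightarrow> W \<inter> U \<inter> Y \<noteq> {} \<Longrightarrow> d \<in> W"
proof -
  obtain D where D: "D \<subseteq> Y" "\<forall>d\<in>D. \<exists>U. openin X U \<and> U \<inter> D = {d}"
    and dense: "\<forall>U. openin X U \<and> U \<inter> Y \<noteq> {} \<longrightarrow> U \<inter> D \<noteq> {}"
    using assms(3) unfolding discrete_dense_subtopology_iff[OF assms(1)]
    by (elim exE conjE) (rule that)
  have "topspace X \<inter> D \<noteq> {}"
    using assms by (intro dense[rule_format]) auto
  then obtain d where d: "d \<in> D"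
    by auto
  then obtain U where U: "openin X U" "U \<inter> D = {d}"
    using D(2) by metis
  have "d \<in> W" if "openin X W" "W \<inter> U \<inter> Y \<noteq> {}" for W
  proof -
    have "W \<inter> U \<inter> D \<noteq> {}"
      using that U by (intro dense[rule_format]) auto
    then show ?thesis
      using U by auto
  qed
  moreover have "d \<in> Y" "d \<in> U"
    using d U D(1) by auto
  ultimately show ?thesis
    using U(1) by (intro that)
qed

text \<open>If \<open>d\<close> is generic in a neighbourhood \<open>U\<close> of it but not isolated, then the rest of \<open>U\<close> again has
  a point \<open>d'\<close> that is generic in a relatively open part of this rest. Then every open set
  around one of \<open>d\<close>, \<open>d'\<close> contains the other, which the \<open>T\<^sub>0\<close> axiom forbids.\<close>

lemma scattered_if_discrete_dense:
  assumes t0: "t0_space X"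
    and dd: "\<And>Y. Y \<subseteq> topspace X \<Longrightarrow> has_discrete_dense_subspace (subtopology X Y)"
  shows "scattered_space X"
  unfolding scattered_space_def
proof (intro allI impI)
  fix Y assume Y: "Y \<subseteq> topspace X" "Y \<noteq> {}"
  obtain d U where d: "d \<in> Y" and U: "openin X U" "d \<in> U"
    and dgen: "\<And>W. openin X W \<Longrightarrow> W \<inter> U \<inter> Y \<noteq> {} \<Longrightarrow> d \<in> W"
    using generic_point_of_discrete_dense[OF Y dd[OF Y(1)]] by metis
  show "\<exists>p\<in>Y. openin (subtopology X Y) {p}"
  proof (rule ccontr)
    assume no: "\<not> ?thesis"
    have not_iso: "W \<inter> Y \<noteq> {d}" if "openin X W" for W
      using no d that by (auto simp: openin_singleton_subtopology)
    define Z where "Z = U \<inter> Y - {d}"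
    have "Z \<noteq> {}" "Z \<subseteq> topspace X"
      using not_iso[OF U(1)] d U Y by (auto simp: Z_def)
    then obtain d' U' where d': "d' \<in> Z" and U': "openin X U'" "d' \<in> U'"
      and d'gen: "\<And>W. openin X W \<Longrightarrow> W \<inter> U' \<inter> Z \<noteq> {} \<Longrightarrow> d' \<in> W"
      using generic_point_of_discrete_dense dd by metis
    have "d \<in> W \<longleftrightarrow> d' \<in> W" if W: "openin X W" for W
    proof
      assume "d' \<in> W"
      then show "d \<in> W"
        using d' by (intro dgen W) (auto simp: Z_def)
    next
      assume "d \<in> W"
      moreover have "d \<in> U'"
        using d' U' by (intro dgen) (auto simp: Z_def)
      ultimately have "d \<in> W \<inter> U \<inter> U' \<inter> Y"
        using d U by auto
      moreover have "W \<inter> U \<inter> U' \<inter> Y \<noteq> {d}"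
        using U U' W by (intro not_iso) auto
      ultimately have "W \<inter> U' \<inter> Z \<noteq> {}"
        by (auto simp: Z_def)
      then show "d' \<in> W"
        by (rule d'gen[OF W])
    qed
    moreover have "d \<noteq> d'" "d \<in> topspace X" "d' \<in> topspace X"
      using d d' Y by (auto simp: Z_def)
    ultimately show False
      using t0 unfolding t0_space_def by blast
  qed
qed

text \<open>The isolated points of \<open>Y\<close> are dense in \<open>Y\<close>: an open set missing them would leave a part of
  \<open>Y\<close> whose isolated points are isolated in \<open>Y\<close> as well.\<close>

lemma discrete_dense_if_scattered:
  assumes sc: "scattered_space X" and Y: "Y \<subseteq> topspace X"
  shows "has_discrete_dense_subspace (subtopology X Y)"
proof -
  define D where "D = {p \<in> Y. \<exists>U. openin X U \<and> U \<inter> Y = {p}}"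
  have DY: "D \<subseteq> Y"
    by (auto simp: D_def)
  have dense: "U \<inter> D \<noteq> {}" if U: "openin X U" "U \<inter> Y \<noteq> {}" for U
  proof -
    have "U \<inter> Y \<subseteq> topspace X"
      using Y by auto
    then obtain p W where p: "p \<in> U \<inter> Y" and W: "openin X W" "W \<inter> (U \<inter> Y) = {p}"
      using sc U unfolding scattered_space_def openin_singleton_subtopology by meson
    then have "(W \<inter> U) \<inter> Y = {p}" "openin X (W \<inter> U)"
      using U by auto
    with p show ?thesis
      unfolding D_def by blast
  qed
  have discrete: "\<exists>U. openin X U \<and> U \<inter> D = {d}" if d: "d \<in> D" for d
  proof -
    obtain U where U: "openin X U" "U \<inter> Y = {d}"
      using d by (auto simp: D_def)
    then have "U \<inter> D = {d}"
      using d DY by auto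
    with U show ?thesis by blast
  qed
  show ?thesis
    unfolding discrete_dense_subtopology_iff[OF Y]
    by (intro exI[of _ D] conjI ballI allI impI DY dense discrete) simp_all
qed

lemma scattered_iff_discrete_dense:
  assumes "t0_space X"
  shows "scattered_space X \<longleftrightarrow>
    (\<forall>Y\<subseteq>topspace X. has_discrete_dense_subspace (subtopology X Y))"
  using assms scattered_if_discrete_dense discrete_dense_if_scattered by blast

lemma t0_space_pt_space: "t0_space (pt_space :: 'a::frame topology)"
  unfolding t0_space_def topspace_pt_space
proof (intro ballI impI)
  fix p q :: 'a assume pq: "p \<in> pt UNIV" "q \<in> pt UNIV" "p \<noteq> q"
  define Op where "Op a = {r \<in> pt UNIV. \<not> a \<le> r}" for a :: 'a
  have op: "openin pt_space (Op a)" for a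
    by (auto simp: openin_pt_space Op_def)
  have "\<not> p \<le> q \<or> \<not> q \<le> p"
    using pq by auto
  then have "\<exists>a. a \<le> p \<longleftrightarrow> \<not> a \<le> q"
    by (metis order_refl)
  then have "\<exists>a. p \<notin> Op a \<longleftrightarrow> q \<in> Op a"
    using pq by (auto simp: Op_def)
  with op show "\<exists>U. openin pt_space U \<and> (p \<notin> U \<longleftrightarrow> q \<in> U)"
    by blast
qed

text \<open>Scatteredness asks for isolated points in all subspaces, absolutely essential primes provide them
  in closed ones. This is enough: an isolated point of the closure of \<open>Y\<close> belongs to \<open>Y\<close>, because
  the neighbourhood that isolates it meets \<open>Y\<close>, and is isolated there.\<close>

lemma scattered_pt_space_iff:
  assumes spatial: "spatial (UNIV :: 'a::frame set)"
  shows "scattered_space (pt_space :: 'a topology) \<longleftrightarrow> (\<forall>a::'a. a \<noteq> top \<longrightarrow> abs_essential a \<noteq> {})"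
proof
  assume sc: "scattered_space (pt_space :: 'a topology)"
  show "\<forall>a::'a. a \<noteq> top \<longrightarrow> abs_essential a \<noteq> {}"
  proof (intro allI impI)
    fix a :: 'a assume a: "a \<noteq> top"
    define V where "V = {q \<in> pt UNIV. a \<le> q}"
    have aV: "Inf V = a"
      using Inf_primes_above[OF spatial] by (simp add: V_def)
    then have "V \<noteq> {}"
      using a by auto
    moreover have "V \<subseteq> topspace pt_space"
      by (auto simp: topspace_pt_space V_def)
    ultimately obtain p U where p: "p \<in> V" "openin pt_space U" "U \<inter> V = {p}"
      using sc unfolding scattered_space_def openin_singleton_subtopology by meson
    then obtain c where c: "U = {q \<in> pt UNIV. \<not> c \<le> q}"
      by (auto simp: openin_pt_space)
    have "\<not> c \<le> p"
      using p c by auto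
    moreover have "c \<le> Inf (V - {p})"
      using p c by (intro Inf_greatest) (auto simp: V_def)
    ultimately have "\<not> Inf (V - {p}) \<le> p"
      using order_trans by blast
    then have "p \<in> abs_essential a"
      using p aV by (subst abs_essential_iff_isolated) (auto simp: V_def)
    then show "abs_essential a \<noteq> {}" by blast
  qed
next
  assume ess: "\<forall>a::'a. a \<noteq> top \<longrightarrow> abs_essential a \<noteq> {}"
  show "scattered_space (pt_space :: 'a topology)"
    unfolding scattered_space_def topspace_pt_space
  proof (intro allI impI)
    fix Y :: "'a set" assume Y: "Y \<subseteq> pt UNIV" "Y \<noteq> {}"
    define a where "a = Inf Y"
    define V where "V = {q \<in> pt UNIV. a \<le> q}"
    have YV: "Y \<subseteq> V"
      using Y by (auto simp: V_def a_def intro: Inf_lower)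
    obtain y where y: "y \<in> Y"
      using Y by blast
    then have "a \<le> y" "y \<noteq> top"
      using Y by (auto simp: a_def pt_def intro: Inf_lower)
    then have "a \<noteq> top"
      by (auto simp: top_unique)
    then obtain p where p: "p \<in> abs_essential a"
      using ess by blast
    have pY: "p \<in> Y"
      using abs_essential_in_meet[OF p Y(1)] a_def by simp
    have iso: "\<not> Inf (V - {p}) \<le> p"
      using p abs_essential_iff_isolated[of a p] Inf_primes_above[OF spatial]
      by (auto simp: V_def)
    define U where "U = {q \<in> pt UNIV. \<not> Inf (V - {p}) \<le> q}"
    have "U \<inter> Y = {p}"
      using iso pY Y YV by (auto simp: U_def intro: Inf_lower)
    moreover have "openin pt_space U"
      by (auto simp: openin_pt_space U_def)
    ultimately show "\<exists>p\<in>Y. openin (subtopology pt_space Y) {p}"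
      using pY by (auto simp: openin_singleton_subtopology)
  qed
qed

section \<open>Coframe isomorphisms as order isomorphisms\<close>

text \<open>\<^const>\<open>coframe_iso\<close> is formulated through meets and joins, which the order determines.\<close>

lemma is_meet_order_iso:
  assumes bij: "bij_betw f A B"
    and ord: "\<And>x y. x \<in> A \<Longrightarrow> y \<in> A \<Longrightarrow> f x \<le> f y \<longleftrightarrow> x \<le> y"
    and "F \<subseteq> A" "m \<in> A"
  shows "is_meet B (f ` F) (f m) \<longleftrightarrow> is_meet A F m"
proof -
  have B: "B = f ` A"
    using bij by (simp add: bij_betw_def)
  show ?thesis
    using assms(3,4) ord unfolding is_meet_def B by (auto simp: subset_iff)
qed

lemma is_join_order_iso:
  assumes bij: "bij_betw f A B"
    and ord: "\<And>x y. x \<in> A \<Longrightarrow> y \<in> A \<Longrightarrow> f x \<le> f y \<longleftrightarrow> x \<le> y"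
    and "F \<subseteq> A" "m \<in> A"
  shows "is_join B (f ` F) (f m) \<longleftrightarrow> is_join A F m"
proof -
  have B: "B = f ` A"
    using bij by (simp add: bij_betw_def)
  show ?thesis
    using assms(3,4) ord unfolding is_join_def B by (auto simp: subset_iff)
qed

lemma coframe_hom_order_iso:
  assumes bij: "bij_betw f A B"
    and ord: "\<And>x y. x \<in> A \<Longrightarrow> y \<in> A \<Longrightarrow> f x \<le> f y \<longleftrightarrow> x \<le> y"
  shows "coframe_hom A B f"
  unfolding coframe_hom_def
proof (intro conjI allI impI)
  show "f ` A \<subseteq> B"
    using bij by (simp add: bij_betw_def)
next
  fix F m assume "F \<subseteq> A" "is_meet A F m"
  then show "is_meet B (f ` F) (f m)"
    using is_meet_order_iso[OF bij ord, of F m] by (simp add: is_meet_def)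
next
  fix F j assume "F \<subseteq> A" "is_join A F j"
  then show "is_join B (f ` F) (f j)"
    using is_join_order_iso[OF bij ord, of F j] by (simp add: is_join_def)
qed

lemma coframe_iso_if_order_iso:
  assumes bij: "bij_betw f A B"
    and ord: "\<And>x y. x \<in> A \<Longrightarrow> y \<in> A \<Longrightarrow> f x \<le> f y \<longleftrightarrow> x \<le> y"
  shows "coframe_iso A B f"
proof -
  let ?g = "the_inv_into A f"
  have g: "bij_betw ?g B A"
    by (rule bij_betw_the_inv_into[OF bij])
  have "?g u \<le> ?g v \<longleftrightarrow> u \<le> v" if "u \<in> B" "v \<in> B" for u v
  proof -
    have "?g u \<in> A" "?g v \<in> A"
      using g that by (auto simp: bij_betw_def)
    moreover have "f (?g u) = u" "f (?g v) = v"
      using that f_the_inv_into_f_bij_betw[OF bij] by auto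
    ultimately show ?thesis
      using ord by metis
  qed
  then show ?thesis
    using bij g ord by (simp add: coframe_iso_def coframe_hom_order_iso)
qed

lemma coframe_hom_mono:
  assumes "coframe_hom A B f" "x \<in> A" "y \<in> A" "x \<le> y"
  shows "f x \<le> f y"
proof -
  have "is_meet A {x, y} x"
    using assms by (auto simp: is_meet_def)
  moreover have "\<forall>F\<subseteq>A. \<forall>m. is_meet A F m \<longrightarrow> is_meet B (f ` F) (f m)"
    using assms(1) by (simp add: coframe_hom_def)
  ultimately have "is_meet B (f ` {x, y}) (f x)"
    using assms(2,3) by (metis empty_subsetI insert_subset)
  then show ?thesis
    by (simp add: is_meet_def)
qed

lemma coframe_iso_le_iff:
  assumes iso: "coframe_iso A B f" and "x \<in> A" "y \<in> A"
  shows "f x \<le> f y \<longleftrightarrow> x \<le> y"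
proof
  have bij: "bij_betw f A B" and inv: "coframe_hom B A (the_inv_into A f)"
    using iso by (auto simp: coframe_iso_def)
  have eq: "the_inv_into A f (f x) = x" "the_inv_into A f (f y) = y"
    using bij assms by (auto simp: bij_betw_def the_inv_into_f_f)
  have "f x \<in> B" "f y \<in> B"
    using bij assms by (auto simp: bij_betw_def)
  then show "x \<le> y" if "f x \<le> f y"
    using coframe_hom_mono[OF inv _ _ that] eq by simp
next
  show "f x \<le> f y" if "x \<le> y"
    using assms that by (auto simp: coframe_iso_def intro: coframe_hom_mono)
qed

lemma boolean_coframe_Pow: "boolean_coframe (Pow X)"
  unfolding boolean_coframe_def
proof (intro exI conjI ballI)
  show "is_join (Pow X) {} {}" "is_meet (Pow X) {} X"
    by (auto simp: is_join_def is_meet_def)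
  show "\<exists>C\<in>Pow X. is_meet (Pow X) {B, C} {} \<and> is_join (Pow X) {B, C} X" if "B \<in> Pow X" for B
    using that by (intro bexI[of _ "X - B"]) (auto simp: is_join_def is_meet_def)
qed

lemma boolean_coframe_iso:
  assumes iso: "coframe_iso A B f" and "boolean_coframe B"
  shows "boolean_coframe A"
proof -
  have bij: "bij_betw f A B"
    using iso by (simp add: coframe_iso_def)
  then have B: "B = f ` A"
    by (simp add: bij_betw_def)
  note meet = is_meet_order_iso[OF bij coframe_iso_le_iff[OF iso]]
  note join = is_join_order_iso[OF bij coframe_iso_le_iff[OF iso]]
  obtain b' t' where b't': "is_join B {} b'" "is_meet B {} t'"
    and compl': "\<And>x. x \<in> B \<Longrightarrow> \<exists>y\<in>B. is_meet B {x, y} b' \<and> is_join B {x, y} t'"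
    using assms(2) by (auto simp: boolean_coframe_def)
  then obtain b t where bt: "b \<in> A" "t \<in> A" "b' = f b" "t' = f t"
    by (auto simp: B is_join_def is_meet_def)
  have "\<exists>y\<in>A. is_meet A {x, y} b \<and> is_join A {x, y} t" if x: "x \<in> A" for x
  proof -
    have "f x \<in> B"
      using x B by auto
    then obtain y where y: "y \<in> A" "is_meet B (f ` {x, y}) (f b)" "is_join B (f ` {x, y}) (f t)"
      using compl'[of "f x"] bt B by auto
    then have "is_meet A {x, y} b" "is_join A {x, y} t"
      using x bt meet[of "{x, y}" b] join[of "{x, y}" t] by auto
    with y show ?thesis by blast
  qed
  moreover have "is_join A {} b" "is_meet A {} t"
    using meet[of "{}" t] join[of "{}" b] b't' bt by auto
  ultimately show ?thesis
    unfolding boolean_coframe_def by blast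
qed

section \<open>The coframe of sublocales\<close>

lemma is_sublocale_above:
  assumes "is_sublocale S"
  shows "is_sublocale {s \<in> S. a \<le> s}"
proof -
  have "a \<le> x \<rightarrow>\<^sub>H s" if "a \<le> s" for x s
    using that by (simp add: le_heyting_imp_iff le_infI1)
  then show ?thesis
    using assms by (auto simp: is_sublocale_def le_Inf_iff)
qed

text \<open>The elements of an atom \<open>S\<close> above a given \<open>s \<noteq> 1\<close> in \<open>S\<close> form a nontrivial sublocale, hence all
  of \<open>S\<close>; so \<open>S\<close> has only one element \<open>p\<close> besides \<open>1\<close>. It is prime because \<open>x \<rightarrow> p\<close> has only two
  possible values.\<close>

lemma atomic_sublocale_is_prime:
  fixes S :: "'a::frame set"
  assumes S: "is_sublocale S" and ne: "S \<noteq> {top}"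
    and atom: "\<And>T. is_sublocale T \<Longrightarrow> T \<subseteq> S \<Longrightarrow> T = {top} \<or> T = S"
  obtains p where "p \<in> pt UNIV" "S = {top, p}"
proof -
  have least: "S = {s \<in> S. a \<le> s}" if "a \<in> S" "a \<noteq> top" for a
    using atom[OF is_sublocale_above[OF S, of a]] that by auto
  obtain p where p: "p \<in> S" "p \<noteq> top"
    using ne top_in_sublocale[OF S] by auto
  have Seq: "S = {top, p}"
  proof (intro equalityI subsetI)
    fix s assume "s \<in> S"
    then show "s \<in> {top, p}"
      using least[OF p] least[of s] p by (auto intro: antisym)
  qed (use p top_in_sublocale[OF S] in auto)
  have "x \<le> p \<or> y \<le> p" if xy: "inf x y \<le> p" for x y
  proof -
    have "x \<rightarrow>\<^sub>H p \<in> {top, p}"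
      using S p Seq unfolding is_sublocale_def by blast
    then consider "x \<rightarrow>\<^sub>H p = top" | "x \<rightarrow>\<^sub>H p = p" by auto
    then show ?thesis
    proof cases
      case 1
      then show ?thesis
        using le_heyting_imp_iff[of top x p] by simp
    next
      case 2
      then show ?thesis
        using xy le_heyting_imp_iff[of y x p] by (simp add: inf.commute)
    qed
  qed
  then have "p \<in> pt UNIV"
    using p by (simp add: pt_def)
  with Seq that show ?thesis by blast
qed

text \<open>Under an isomorphism every singleton \<open>{p}\<close> corresponds to an atom \<open>{1, q}\<close> with \<open>q\<close> prime.
  The sublocale generated by all primes contains all these atoms, so it corresponds to the whole
  powerset and is the largest sublocale.\<close>

lemma spatial_if_coframe_iso_Pow:
  assumes iso: "coframe_iso sublocales (Pow X) (f :: 'a::frame set \<Rightarrow> 'b set)"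
  shows "spatial (UNIV :: 'a set)"
proof -
  note le = coframe_iso_le_iff[OF iso]
  have img: "f ` sublocales = Pow X" and inj: "inj_on f sublocales"
    using iso by (auto simp: coframe_iso_def bij_betw_def)
  define T :: "'a set" where "T = meets (pt UNIV)"
  have T: "T \<in> sublocales"
    by (simp add: T_def sublocales_def is_sublocale_meets)
  have U: "UNIV \<in> sublocales"
    by (simp add: sublocales_def is_sublocale_UNIV)
  have tr: "{top} \<in> sublocales"
    by (simp add: sublocales_def is_sublocale_top)
  have ftop: "f {top} = {}"
  proof -
    obtain E where E: "E \<in> sublocales" "f E = {}"
      using img by (metis Pow_bottom imageE)
    then have "{top} \<subseteq> E"
      using top_in_sublocale by (auto simp: sublocales_def)
    then show ?thesis
      using le[OF tr E(1)] E by auto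
  qed
  have "x \<in> f T" if x: "x \<in> X" for x
  proof -
    have "{x} \<in> f ` sublocales"
      using img x by auto
    then obtain S where S: "S \<in> sublocales" "f S = {x}"
      by auto
    have "S' = {top} \<or> S' = S" if S': "is_sublocale S'" "S' \<subseteq> S" for S'
    proof -
      have S'': "S' \<in> sublocales"
        using S' by (simp add: sublocales_def)
      then have "f S' \<subseteq> {x}"
        using le[OF S'' S(1)] S S' by simp
      then have "f S' = f {top} \<or> f S' = f S"
        using ftop S by auto
      then show ?thesis
        using inj S'' S tr by (auto dest: inj_onD)
    qed
    moreover have "S \<noteq> {top}"
      using S ftop by auto
    ultimately obtain p where p: "p \<in> pt UNIV" "S = {top, p}"
      using atomic_sublocale_is_prime[of S] S by (auto simp: sublocales_def)
    have "S \<subseteq> T"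
      using p top_in_sublocale[of T] T subset_meets[of "pt UNIV"]
      by (auto simp: sublocales_def T_def)
    then show ?thesis
      using le[OF S(1) T] S by auto
  qed
  moreover have "f UNIV \<subseteq> X"
    using img U by auto
  ultimately have "f UNIV \<subseteq> f T"
    by auto
  then have "UNIV \<subseteq> T"
    using le[OF U T] by simp
  then show ?thesis
    by (simp add: spatial_iff_subset_meets T_def)
qed

lemma heyting_imp_inf: "x \<rightarrow>\<^sub>H inf s t = inf (x \<rightarrow>\<^sub>H s) (x \<rightarrow>\<^sub>H (t::'a::frame))"
  by (rule antisym) (meson le_heyting_imp_iff le_inf_iff order_refl)+

lemma is_sublocale_binary_join:
  fixes S T :: "'a::frame set"
  assumes S: "is_sublocale S" and T: "is_sublocale T"
  shows "is_sublocale {inf s t | s t. s \<in> S \<and> t \<in> T}" (is "is_sublocale ?J")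
  unfolding is_sublocale_def
proof (intro conjI allI impI ballI)
  fix M assume M: "M \<subseteq> ?J"
  define A where "A = {s \<in> S. \<exists>t\<in>T. inf s t \<in> M}"
  define B where "B = {t \<in> T. \<exists>s\<in>S. inf s t \<in> M}"
  have "Inf M = inf (Inf A) (Inf B)"
  proof (rule antisym)
    show "Inf M \<le> inf (Inf A) (Inf B)"
      by (auto simp: A_def B_def intro!: Inf_greatest intro: order_trans[OF Inf_lower])
  next
    show "inf (Inf A) (Inf B) \<le> Inf M"
    proof (rule Inf_greatest)
      fix m assume m: "m \<in> M"
      then obtain s t where st: "m = inf s t" "s \<in> S" "t \<in> T"
        using M by blast
      then have "s \<in> A" "t \<in> B"
        using m by (auto simp: A_def B_def)
      then show "inf (Inf A) (Inf B) \<le> m"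
        unfolding st by (intro inf_mono Inf_lower)
    qed
  qed
  moreover have "Inf A \<in> S" "Inf B \<in> T"
    using S T by (auto simp: is_sublocale_def A_def B_def)
  ultimately show "Inf M \<in> ?J" by blast
next
  fix x j assume "j \<in> ?J"
  then obtain s t where st: "j = inf s t" "s \<in> S" "t \<in> T" by blast
  then have "x \<rightarrow>\<^sub>H s \<in> S" "x \<rightarrow>\<^sub>H t \<in> T"
    using S T by (auto simp: is_sublocale_def)
  then show "x \<rightarrow>\<^sub>H j \<in> ?J"
    using st by (auto simp: heyting_imp_inf)
qed

lemma sublocale_complement:
  fixes S :: "'a::frame set"
  assumes bool: "boolean_coframe (sublocales :: 'a set set)" and S: "is_sublocale S"
  obtains T where "is_sublocale T" "S \<inter> T = {top}" "\<And>a. \<exists>s\<in>S. \<exists>t\<in>T. a = inf s t"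
proof -
  obtain b t :: "'a set" where b: "is_join sublocales {} b" and t: "is_meet sublocales {} t"
    and compl: "\<And>x. x \<in> sublocales \<Longrightarrow>
      \<exists>y\<in>sublocales. is_meet sublocales {x, y} b \<and> is_join sublocales {x, y} t"
    using bool unfolding boolean_coframe_def by metis
  obtain T where T: "is_sublocale T" and m: "is_meet sublocales {S, T} b"
    and j: "is_join sublocales {S, T} t"
    using compl[of S] S by (auto simp: sublocales_def)
  have "b \<subseteq> {top}"
    using b is_sublocale_top by (auto simp: is_join_def sublocales_def)
  moreover have "S \<inter> T \<subseteq> b"
  proof -
    have "is_sublocale (S \<inter> T)"
      using S T by (auto simp: is_sublocale_def)
    then show ?thesis
      using m by (auto simp: is_meet_def sublocales_def)
  qed
  ultimately have meet: "S \<inter> T = {top}"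
    using top_in_sublocale[OF S] top_in_sublocale[OF T] by auto
  define J where "J = {inf s t | s t. s \<in> S \<and> t \<in> T}"
  have "UNIV \<subseteq> t"
    using t is_sublocale_UNIV by (auto simp: is_meet_def sublocales_def)
  moreover have "t \<subseteq> J"
  proof -
    have "inf s top \<in> J" if "s \<in> S" for s
      unfolding J_def using that top_in_sublocale[OF T] by blast
    moreover have "inf top u \<in> J" if "u \<in> T" for u
      unfolding J_def using that top_in_sublocale[OF S] by blast
    ultimately have "S \<subseteq> J" "T \<subseteq> J"
      by (simp_all add: subset_iff)
    moreover have "J \<in> sublocales"
      using is_sublocale_binary_join[OF S T] by (simp add: sublocales_def J_def)
    ultimately show ?thesis
      using j by (simp add: is_join_def)
  qed
  ultimately have "a \<in> J" for a by blast
  then have "\<exists>s\<in>S. \<exists>t\<in>T. a = inf s t" for a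
    unfolding J_def by blast
  then show ?thesis
    by (rule that[OF T meet])
qed

text \<open>A prime that is a binary meet equals one of the two factors.\<close>

lemma prime_in_complement:
  assumes "\<And>a. \<exists>s\<in>S. \<exists>t\<in>T. a = inf s t" and p: "p \<in> pt UNIV"
  shows "p \<in> S \<or> p \<in> T"
proof -
  obtain s t where st: "s \<in> S" "t \<in> T" "p = inf s t"
    using assms(1) by blast
  then have "s \<le> p \<or> t \<le> p"
    using prime_inf_le_iff[OF p, of s t] by simp
  then have "s = p \<or> t = p"
    using st by (metis antisym inf_le1 inf_le2)
  with st(1,2) show ?thesis by blast
qed

section \<open>From absolutely essential primes to the powerset\<close>

lemma totally_spatial_if_abs_essential:
  assumes ess: "\<And>a::'a::frame. a = Inf (abs_essential a)"
  shows "totally_spatial TYPE('a)"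
  unfolding totally_spatial_def
proof
  fix S :: "'a set" assume "S \<in> sublocales"
  then have S: "is_sublocale S"
    by (simp add: sublocales_def)
  have "abs_essential a \<subseteq> pt S" if "a \<in> S" for a
    unfolding pt_sublocale[OF S]
    using abs_essential_in_sublocale[OF S that] by (auto simp: abs_essential_def)
  then show "spatial S"
    using ess unfolding spatial_def by blast
qed

lemma weakly_covered_if_abs_essential:
  fixes p :: "'a::frame"
  assumes "p = Inf (abs_essential p)" and p: "p \<in> pt UNIV"
  shows "weakly_covered p"
proof -
  have "p \<noteq> top"
    using p by (simp add: pt_def)
  then have "abs_essential p \<noteq> {}"
    using assms(1) by (metis Inf_empty)
  moreover have "abs_essential p \<subseteq> {p}"
    using p abs_essential_in_meet[of _ p "{p}"] by auto
  ultimately have "p \<in> abs_essential p"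
    by blast
  then show ?thesis
    by (auto simp: weakly_covered_def abs_essential_def)
qed

text \<open>Spatial sublocales are determined by their primes, which gives injectivity together with order
  reflection. A set \<open>Y\<close> of primes is the image of \<open>meets Y\<close>, to which weak covering allows no further
  prime.\<close>

lemma coframe_iso_pt:
  assumes ts: "totally_spatial TYPE('a::frame)"
    and wc: "\<And>p::'a. p \<in> pt UNIV \<Longrightarrow> weakly_covered p"
  shows "coframe_iso sublocales (Pow (pt UNIV)) (\<lambda>S :: 'a set. pt UNIV \<inter> S)"
proof (rule coframe_iso_if_order_iso)
  have le: "S \<subseteq> T" if "S \<in> sublocales" "T \<in> sublocales" "pt UNIV \<inter> S \<subseteq> T" for S T :: "'a set"
  proof -
    have "S \<subseteq> meets (pt UNIV \<inter> S)"
      using ts that by (simp add: totally_spatial_def spatial_iff_subset_meets sublocales_def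
          pt_sublocale)
    also have "\<dots> \<subseteq> T"
      using that by (intro meets_least_sublocale) (auto simp: sublocales_def)
    finally show ?thesis .
  qed
  then show "pt UNIV \<inter> S \<le> pt UNIV \<inter> T \<longleftrightarrow> S \<le> T"
    if "S \<in> sublocales" "T \<in> sublocales" for S T :: "'a set"
    using that by auto
  have "pt UNIV \<inter> meets Y = Y" if Y: "Y \<subseteq> pt UNIV" for Y :: "'a set"
  proof
    show "Y \<subseteq> pt UNIV \<inter> meets Y"
      using Y subset_meets by auto
    show "pt UNIV \<inter> meets Y \<subseteq> Y"
    proof
      fix p assume p: "p \<in> pt UNIV \<inter> meets Y"
      then obtain P where P: "P \<subseteq> Y" "p = Inf P"
        by (auto simp: meets_def)
      then have "p \<in> P"
        using p Y wc[of p] unfolding weakly_covered_def by (metis IntD1 subset_trans)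
      with P(1) show "p \<in> Y" by (rule subsetD)
    qed
  qed
  then have surj: "Y \<in> (\<lambda>S. pt UNIV \<inter> S) ` sublocales" if "Y \<subseteq> pt UNIV" for Y :: "'a set"
    using that is_sublocale_meets[OF that] unfolding sublocales_def by (metis imageI mem_Collect_eq)
  show "bij_betw (\<lambda>S :: 'a set. pt UNIV \<inter> S) sublocales (Pow (pt UNIV))"
  proof (rule bij_betw_imageI)
    show "inj_on (\<lambda>S :: 'a set. pt UNIV \<inter> S) sublocales"
      using le by (intro inj_onI equalityI) (metis inf_le2)+
    show "(\<lambda>S :: 'a set. pt UNIV \<inter> S) ` sublocales = Pow (pt UNIV)"
      using surj by auto
  qed
qed

section \<open>From complemented sublocales to absolutely essential primes\<close>

text \<open>The complement of \<open>{1, p}\<close> contains every prime other than \<open>p\<close>, and with them all their meets,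
  whereas it does not contain \<open>p\<close>.\<close>

lemma weakly_covered_if_boolean:
  fixes p :: "'a::frame"
  assumes bool: "boolean_coframe (sublocales :: 'a set set)" and p: "p \<in> pt UNIV"
  shows "weakly_covered p"
  unfolding weakly_covered_def
proof (intro allI impI, rule ccontr)
  fix P assume P: "P \<subseteq> pt UNIV" "p = Inf P" "p \<notin> P"
  have single: "meets {p} = {top, p}"
    by (auto simp: meets_def subset_singleton_iff intro: exI[of _ "{p}"])
  then have "is_sublocale {top, p}"
    using is_sublocale_meets[of "{p}"] p by simp
  then obtain T where T: "is_sublocale T" "{top, p} \<inter> T = {top}"
    and join: "\<And>a. \<exists>s\<in>{top, p}. \<exists>t\<in>T. a = inf s t"
    using sublocale_complement[OF bool] by metis
  have "p \<notin> T"
    using T p by (auto simp: pt_def)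
  have "P \<subseteq> T"
  proof
    fix q assume "q \<in> P"
    then show "q \<in> T"
      using P prime_in_complement[OF join, of q] by (auto simp: pt_def)
  qed
  then have "p \<in> T"
    using T P by (auto simp: is_sublocale_def)
  with \<open>p \<notin> T\<close> show False ..
qed

lemma heyting_imp_curry: "x \<rightarrow>\<^sub>H y \<rightarrow>\<^sub>H a = inf x y \<rightarrow>\<^sub>H (a :: 'a::frame)"
  by (rule antisym) (metis le_heyting_imp_iff inf.assoc order_refl)+

lemma is_sublocale_heyting_imps:
  fixes a :: "'a::frame"
  shows "is_sublocale (range (\<lambda>x. x \<rightarrow>\<^sub>H a))"
  unfolding is_sublocale_def
proof (intro conjI allI impI ballI)
  fix M assume M: "M \<subseteq> range (\<lambda>x. x \<rightarrow>\<^sub>H a)"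
  define A where "A = {x. x \<rightarrow>\<^sub>H a \<in> M}"
  have "z \<le> Sup A \<rightarrow>\<^sub>H a \<longleftrightarrow> z \<le> Inf M" for z
  proof -
    have "z \<le> Sup A \<rightarrow>\<^sub>H a \<longleftrightarrow> (\<forall>x\<in>A. inf z x \<le> a)"
      by (simp add: le_heyting_imp_iff inf_Sup_frame Sup_le_iff)
    also have "\<dots> \<longleftrightarrow> (\<forall>m\<in>M. z \<le> m)"
      using M by (auto simp: A_def le_heyting_imp_iff[symmetric])
    finally show ?thesis
      by (simp add: le_Inf_iff)
  qed
  then have "Inf M = Sup A \<rightarrow>\<^sub>H a"
    by (meson antisym order_refl)
  then show "Inf M \<in> range (\<lambda>x. x \<rightarrow>\<^sub>H a)" by blast
next
  fix x s assume "s \<in> range (\<lambda>x. x \<rightarrow>\<^sub>H a)"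
  then show "x \<rightarrow>\<^sub>H s \<in> range (\<lambda>x. x \<rightarrow>\<^sub>H a)"
    by (auto simp: heyting_imp_curry)
qed

text \<open>A prime of the form \<open>x \<rightarrow> a\<close> is, for every representation of \<open>a\<close> as a meet of primes, the meet
  of those not above \<open>x\<close>, so by weak covering it is one of them. Such a prime exists: if the least
  sublocale containing \<open>a\<close> had no primes, its complement would contain all of them, so by
  spatiality it would be the whole frame.\<close>

lemma abs_essential_nonempty_if_boolean:
  fixes a :: "'a::frame"
  assumes bool: "boolean_coframe (sublocales :: 'a set set)"
    and spatial: "spatial (UNIV :: 'a set)" and a: "a \<noteq> top"
  shows "abs_essential a \<noteq> {}"
proof -
  let ?B = "range (\<lambda>x. x \<rightarrow>\<^sub>H a)"
  obtain T where T: "is_sublocale T" "?B \<inter> T = {top}"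
    and join: "\<And>a. \<exists>s\<in>?B. \<exists>t\<in>T. a = inf s t"
    using sublocale_complement[OF bool is_sublocale_heyting_imps] by metis
  have "top \<rightarrow>\<^sub>H a \<le> a"
    using le_heyting_imp_iff[of "top \<rightarrow>\<^sub>H a" top a] by simp
  then have "top \<rightarrow>\<^sub>H a = a"
    by (intro antisym) (simp_all add: le_heyting_imp_iff)
  then have "a \<in> ?B" by (metis rangeI)
  then have "a \<notin> T"
    using T a by blast
  then have "\<not> meets (pt UNIV) \<subseteq> T"
    using spatial by (auto simp: spatial_iff_subset_meets)
  then have "\<not> pt UNIV \<subseteq> T"
    using meets_least_sublocale[OF T(1)] by blast
  then obtain p where p: "p \<in> pt UNIV" "p \<in> ?B"
    using prime_in_complement[OF join] by blast
  then obtain x where x: "p = x \<rightarrow>\<^sub>H a" by blast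
  have ess: "p \<in> P" if P: "P \<subseteq> pt UNIV" "a = Inf P" for P
  proof -
    have "p = Inf {q \<in> P. \<not> x \<le> q}"
      using P x by (simp add: heyting_imp_Inf_primes)
    moreover have "{q \<in> P. \<not> x \<le> q} \<subseteq> pt UNIV"
      using P by auto
    ultimately have "p \<in> {q \<in> P. \<not> x \<le> q}"
      using weakly_covered_if_boolean[OF bool p(1)] unfolding weakly_covered_def by blast
    then show ?thesis by simp
  qed
  have "a \<le> p"
    by (simp add: x le_heyting_imp_iff)
  then have "p \<in> abs_essential a"
    using ess p(1) Inf_primes_above[OF spatial, of a] by (simp add: abs_essential_def)
  then show ?thesis by blast
qed

section \<open>The equivalence\<close>

lemma all_equivalent_if_implications:
  assumes "c1 \<longleftrightarrow> c6" "c1 \<longleftrightarrow> c8"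
    and "c6 \<Longrightarrow> c7" "c7 \<Longrightarrow> c2" "c2 \<Longrightarrow> c3" "c3 \<Longrightarrow> c4" "c4 \<Longrightarrow> c5" "c5 \<Longrightarrow> c6"
  shows "all_equivalent [c1, c2, c3, c4, c5, c6, c7, c8]"
proof -
  have "c1 \<longleftrightarrow> c6" "c2 \<longleftrightarrow> c6" "c3 \<longleftrightarrow> c6" "c4 \<longleftrightarrow> c6" "c5 \<longleftrightarrow> c6" "c7 \<longleftrightarrow> c6" "c8 \<longleftrightarrow> c6"
    using assms by blast+
  then show ?thesis
    by (simp add: all_equivalent_def)
qed

theorem theorem5p31:
  shows "all_equivalent
    [spatial (UNIV :: 'a::frame set) \<and> scattered_space (pt_space :: 'a topology),
     totally_spatial TYPE('a) \<and> (\<forall>p\<in>pt (UNIV :: 'a set). weakly_covered p),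
     coframe_iso sublocales (Pow (pt UNIV)) (\<lambda>S :: 'a set. pt UNIV \<inter> S),
     (\<exists>f. coframe_iso (sublocales :: 'a set set) (Pow (pt (UNIV :: 'a set))) f),
     boolean_coframe (sublocales :: 'a set set) \<and> spatial (UNIV :: 'a set),
     spatial (UNIV :: 'a set) \<and> (\<forall>a::'a. a \<noteq> top \<longrightarrow> abs_essential a \<noteq> {}),
     (\<forall>a::'a. a = Inf (abs_essential a)),
     spatial (UNIV :: 'a set) \<and>
       (\<forall>Y\<subseteq>pt (UNIV :: 'a set). has_discrete_dense_subspace (subtopology pt_space Y))]"
    (is "all_equivalent [?c1, ?c2, ?c3, ?c4, ?c5, ?c6, ?c7, ?c8]")
proof (rule all_equivalent_if_implications)
  show "?c1 \<longleftrightarrow> ?c6"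
    using scattered_pt_space_iff by blast
  show "?c1 \<longleftrightarrow> ?c8"
    using scattered_iff_discrete_dense[OF t0_space_pt_space] by (auto simp: topspace_pt_space)
  show "?c6 \<Longrightarrow> ?c7"
    using eq_Inf_abs_essential by blast
  show "?c7 \<Longrightarrow> ?c2"
    using totally_spatial_if_abs_essential weakly_covered_if_abs_essential by blast
  show "?c2 \<Longrightarrow> ?c3"
    using coframe_iso_pt by blast
  show "?c3 \<Longrightarrow> ?c4"
    by blast
  show "?c4 \<Longrightarrow> ?c5"
    using boolean_coframe_iso[OF _ boolean_coframe_Pow] spatial_if_coframe_iso_Pow by blast
  show "?c5 \<Longrightarrow> ?c6"
    using abs_essential_nonempty_if_boolean by blast
qed

end
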